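(* Let $R$ be a Noetherian integral domain. Then an ideal $J$ in $R$ is a big ideal if and only if whenever $I \subsetneq J$ is an ideal, one has $J \nsubseteq I^*$.
   Context: All rings are commutative with identity $1\neq 0$. An ideal $J$ of a ring $R$ is called a big ideal if for every ideal $I\subsetneq J$ one has $I^n\subsetneq J^n$ for all $n\geq 1$. For an ideal $I$ in a Noetherian ring $R$, $I^* = \bigcup_{m\geq 1} (I^{m+1} : I^m)$, where $(A:B)=\{r\in R : rB\subseteq A\}$.
   Formalization: The condition on the right is required only for nonzero ideals I properly contained in J; with I = 0 one has 0* = R, so the literal claim fails, for example, for the big ideal J = R. *)

theory Defs
  imports "HOL-Algebra.Algebra"
begin

(* The power I^n is the power in the monoid of ideals of R; thus I^0 = R. *)
abbreviation ideal_pow :: "('a, 'b) ring_scheme \<Rightarrow> 'a set \<Rightarrow> nat \<Rightarrow> 'a set" where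
  "ideal_pow R I n \<equiv> I [^]\<^bsub>ideals_set R\<^esub> n"

definition ideal_colon :: "('a, 'b) ring_scheme \<Rightarrow> 'a set \<Rightarrow> 'a set \<Rightarrow> 'a set" where
  "ideal_colon R A B = {r \<in> carrier R. r <#\<^bsub>R\<^esub> B \<subseteq> A}"

definition big_ideal :: "('a, 'b) ring_scheme \<Rightarrow> 'a set \<Rightarrow> bool" where
  "big_ideal R J \<longleftrightarrow>
     ideal J R \<and>
     (\<forall>I. ideal I R \<and> I \<subset> J \<longrightarrow> (\<forall>n\<ge>1. ideal_pow R I n \<subset> ideal_pow R J n))"

(* The Ratliff-Rush closure. It behaves as a closure operation only for ideals
   containing a nonzerodivisor: by the lemma below, the formula gives the whole
   ring for the zero ideal. *)
definition ratliff_rush :: "('a, 'b) ring_scheme \<Rightarrow> 'a set \<Rightarrow> 'a set" where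
  "ratliff_rush R I = (\<Union>m\<in>{1..}. ideal_colon R (ideal_pow R I (m + 1)) (ideal_pow R I m))"

lemma (in cring) ratliff_rush_zero: "ratliff_rush R {\<zero>} = carrier R"
proof -
  interpret S: comm_monoid "ideals_set R" by (rule ideals_set_is_comm_monoid)
  have c: "{\<zero>} \<in> carrier (ideals_set R)" by (simp add: ideals_set_def zeroideal)
  have p: "ideal_pow R {\<zero>} (Suc n) = {\<zero>}" for n
  proof -
    have "ideal (ideal_pow R {\<zero>} n) R"
      using S.nat_pow_closed[OF c] by (simp add: ideals_set_def)
    then show ?thesis using ideal_prod_zero by (simp add: ideals_set_def)
  qed
  have "r \<in> ratliff_rush R {\<zero>}" if "r \<in> carrier R" for r
    using that p[of 0] p[of 1] unfolding ratliff_rush_def ideal_colon_def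
    by (intro UN_I[of 1]) (auto simp: l_coset_def)
  then show ?thesis by (auto simp: ratliff_rush_def ideal_colon_def)
qed

end

theory Submission
  imports Defs
begin

text \<open>
  If \<open>J \<subseteq> I\<^sup>*\<close> with \<open>I \<noteq> 0\<close>, then \<open>J I\<^sup>m \<subseteq> I I\<^sup>m\<close> for some \<open>m \<ge> 1\<close>, because \<open>J\<close> is finitely
  generated. Instead of the determinant trick, the generators of \<open>M = I\<^sup>m\<close> are eliminated one at
  a time: if \<open>A (c R + M') \<subseteq> L (c R + M')\<close> with \<open>L \<subseteq> A\<close>, then \<open>A\<^sup>2 M' \<subseteq> A L M'\<close>. Once a single
  nonzero generator is left it cancels, and this yields \<open>J\<^sup>n\<^sup>+\<^sup>1 \<subseteq> I J\<^sup>n\<close> for some \<open>n\<close>. Hence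
  \<open>J\<^sup>n\<^sup>+\<^sup>m = I\<^sup>m J\<^sup>n \<subseteq> I\<^sup>n\<^sup>+\<^sup>m\<close>, so that \<open>J\<close> is not big. Conversely, \<open>I\<^sup>n = J\<^sup>n\<close> with \<open>I \<subseteq> J\<close> forces
  \<open>J\<^sup>n = I J\<^sup>n\<^sup>-\<^sup>1\<close>, so \<open>J I\<^sup>n = J\<^sup>n\<^sup>+\<^sup>1 = I J\<^sup>n = I\<^sup>n\<^sup>+\<^sup>1\<close> and \<open>J \<subseteq> I\<^sup>*\<close>.
\<close>

section \<open>Products and powers of ideals\<close>

lemma ideal_prod_mono:
  assumes "I \<subseteq> I'" "J \<subseteq> J'"
  shows "I \<cdot>\<^bsub>R\<^esub> J \<subseteq> I' \<cdot>\<^bsub>R\<^esub> J'"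
proof
  fix s assume "s \<in> I \<cdot>\<^bsub>R\<^esub> J"
  then show "s \<in> I' \<cdot>\<^bsub>R\<^esub> J'"
    using assms by induct (auto intro: ideal_prod.intros)
qed

lemma (in ring) ideal_prod_subsetI:
  assumes "ideal K R" "\<And>i j. i \<in> I \<Longrightarrow> j \<in> J \<Longrightarrow> i \<otimes> j \<in> K"
  shows "I \<cdot> J \<subseteq> K"
proof
  fix s assume "s \<in> I \<cdot> J"
  then show "s \<in> K"
    using assms by induct (auto intro: additive_subgroup.a_closed ideal.axioms(1))
qed

lemma ideal_pow_0: "ideal_pow R I 0 = carrier R"
  by (simp add: ideals_set_def)

lemma ideal_pow_Suc: "ideal_pow R I (Suc n) = ideal_pow R I n \<cdot>\<^bsub>R\<^esub> I"
  by (simp add: ideals_set_def)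

context cring
begin

lemma ideal_pow_ideal: "ideal I R \<Longrightarrow> ideal (ideal_pow R I n) R"
  using monoid.nat_pow_closed[OF comm_monoid.axioms(1)[OF ideals_set_is_comm_monoid], of I n]
  by (simp add: ideals_set_def)

lemma ideal_pow_add:
  "ideal I R \<Longrightarrow> ideal_pow R I m \<cdot> ideal_pow R I n = ideal_pow R I (m + n)"
  using monoid.nat_pow_mult[OF comm_monoid.axioms(1)[OF ideals_set_is_comm_monoid], of I m n]
  by (simp add: ideals_set_def)

lemma ideal_pow_1: "ideal I R \<Longrightarrow> ideal_pow R I (Suc 0) = I"
  by (simp only: ideal_pow_Suc ideal_pow_0 ideal_prod_one ideal_prod_commute[of "carrier R" I] oneideal)

lemma ideal_pow_Suc2: "ideal I R \<Longrightarrow> ideal_pow R I (Suc n) = I \<cdot> ideal_pow R I n"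
  by (simp only: ideal_pow_Suc ideal_pow_ideal ideal_prod_commute)

lemma ideal_pow_mono: "I \<subseteq> J \<Longrightarrow> ideal_pow R I n \<subseteq> ideal_pow R J n"
proof (induct n)
  case 0
  show ?case by (simp only: ideal_pow_0)
next
  case (Suc n)
  then show ?case unfolding ideal_pow_Suc by (intro ideal_prod_mono)
qed

text \<open>By induction on \<open>k\<close>, each factor \<open>A\<close> is traded for a factor
  \<open>B\<close> against the multiplier \<open>M\<close>. \<open>M\<close> survives every trade
  and is available for the next one.\<close>

lemma ideal_prod_pow_subset:
  assumes "ideal A R" "ideal B R" "ideal M R" "A \<cdot> M \<subseteq> B \<cdot> M"
  shows "ideal_pow R A k \<cdot> M \<subseteq> ideal_pow R B k \<cdot> M"
proof (induct k)
  case 0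
  show ?case by (simp only: ideal_pow_0)
next
  case (Suc k)
  let ?A = "ideal_pow R A k" and ?B = "ideal_pow R B k"
  note ids = assms(1-3) ideal_pow_ideal[OF assms(1)] ideal_pow_ideal[OF assms(2)] ideal_prod_is_ideal
  have "ideal_pow R A (Suc k) \<cdot> M = ?A \<cdot> (A \<cdot> M)"
    unfolding ideal_pow_Suc by (intro ideal_prod_assoc ids)
  also have "\<dots> \<subseteq> ?A \<cdot> (B \<cdot> M)"
    by (intro ideal_prod_mono assms order_refl)
  also have "\<dots> = ?A \<cdot> (M \<cdot> B)"
    by (simp only: ideal_prod_commute[of B M] ids)
  also have "\<dots> = (?A \<cdot> M) \<cdot> B"
    by (intro ideal_prod_assoc[symmetric] ids)
  also have "\<dots> \<subseteq> (?B \<cdot> M) \<cdot> B"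
    by (intro ideal_prod_mono Suc order_refl)
  also have "\<dots> = ?B \<cdot> (M \<cdot> B)"
    by (intro ideal_prod_assoc ids)
  also have "\<dots> = ?B \<cdot> (B \<cdot> M)"
    by (simp only: ideal_prod_commute[of B M] ids)
  also have "\<dots> = ideal_pow R B (Suc k) \<cdot> M"
    unfolding ideal_pow_Suc by (intro ideal_prod_assoc[symmetric] ids)
  finally show ?case .
qed

section \<open>Principal ideals and the elimination of a generator\<close>

lemma ideal_prod_cgenideal:
  assumes "ideal L R" "b \<in> carrier R"
  shows "L \<cdot> (PIdl b) = {l \<otimes> b |l. l \<in> L}"
proof
  interpret L: ideal L R by fact
  show "L \<cdot> (PIdl b) \<subseteq> {l \<otimes> b |l. l \<in> L}"
  proof
    fix s assume "s \<in> L \<cdot> (PIdl b)"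
    then show "s \<in> {l \<otimes> b |l. l \<in> L}"
    proof induct
      case (prod i j)
      then obtain r where "r \<in> carrier R" "j = r \<otimes> b" by (auto simp: cgenideal_def)
      with prod assms(2) have "i \<otimes> j = (i \<otimes> r) \<otimes> b" "i \<otimes> r \<in> L"
        by (auto simp: m_assoc L.I_r_closed L.Icarr)
      then show ?case by blast
    next
      case (sum s1 s2)
      then obtain l1 l2 where l: "l1 \<in> L" "l2 \<in> L" "s1 = l1 \<otimes> b" "s2 = l2 \<otimes> b" by auto
      then have "s1 \<oplus> s2 = (l1 \<oplus> l2) \<otimes> b" "l1 \<oplus> l2 \<in> L"
        using assms(2) by (auto simp: l_distr L.Icarr)
      then show ?case by blast
    qed
  qed
  show "{l \<otimes> b |l. l \<in> L} \<subseteq> L \<cdot> (PIdl b)"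
    using cgenideal_self[OF assms(2)] by (auto intro: ideal_prod.prod)
qed

lemma genideal_insert:
  assumes "c \<in> carrier R" "B \<subseteq> carrier R"
  shows "Idl (insert c B) = PIdl c <+> Idl B"
proof -
  have c: "ideal (PIdl c) R" "c \<in> PIdl c"
    using assms(1) by (auto intro: cgenideal_ideal cgenideal_self)
  have B: "ideal (Idl B) R" "B \<subseteq> Idl B"
    using assms(2) by (simp_all add: genideal_ideal genideal_self)
  have carr: "PIdl c \<union> Idl B \<subseteq> carrier R"
    using ideal.Icarr[OF c(1)] ideal.Icarr[OF B(1)] by blast
  have "Idl (insert c B) = Idl (PIdl c \<union> Idl B)"
  proof
    have "insert c B \<subseteq> Idl (PIdl c \<union> Idl B)"
      using c(2) B(2) genideal_self[OF carr] by blast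
    then show "Idl (insert c B) \<subseteq> Idl (PIdl c \<union> Idl B)"
      by (intro genideal_minimal genideal_ideal carr)
    have i: "ideal (Idl (insert c B)) R" and s: "insert c B \<subseteq> Idl (insert c B)"
      using assms by (intro genideal_ideal genideal_self; blast)+
    have "PIdl c \<union> Idl B \<subseteq> Idl (insert c B)"
      using s by (intro Un_least cgenideal_minimal genideal_minimal i) auto
    then show "Idl (PIdl c \<union> Idl B) \<subseteq> Idl (insert c B)"
      by (intro genideal_minimal i)
  qed
  also have "\<dots> = PIdl c <+> Idl B"
    by (intro union_genideal c B)
  finally show ?thesis .
qed

text \<open>This is one step of Gaussian elimination. Both \<open>y \<otimes> c\<close> with
  \<open>y\<close> in \<open>A\<close> and any \<open>w\<close> in \<open>A \<cdot> M\<close> have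
  the form (element of \<open>L\<close>) times \<open>c\<close> plus an element of
  \<open>L \<cdot> M\<close>. Combining the two relations removes \<open>c\<close>, at the price of
  one more factor \<open>A\<close> on each side.\<close>

lemma ideal_prod_eliminate:
  assumes A: "ideal A R" and L: "ideal L R" and M: "ideal M R" and "L \<subseteq> A"
    and c: "c \<in> carrier R"
    and le: "A \<cdot> (PIdl c <+> M) \<subseteq> L \<cdot> (PIdl c <+> M)"
  shows "(A \<cdot> A) \<cdot> M \<subseteq> (A \<cdot> L) \<cdot> M"
proof -
  interpret A: ideal A R by fact
  interpret L: ideal L R by fact
  have AM: "ideal (A \<cdot> M) R" and LM: "ideal (L \<cdot> M) R"
    using A L M by (auto intro: ideal_prod_is_ideal)
  have T: "ideal (A \<cdot> (L \<cdot> M)) R"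
    using A LM by (rule ideal_prod_is_ideal)
  have P: "ideal (PIdl c) R" using c by (rule cgenideal_ideal)
  have cM: "c \<in> PIdl c <+> M"
    using cgenideal_self[OF c] additive_subgroup.zero_closed[OF ideal.axioms(1)[OF M]] c
    by (force simp: set_add_def')
  have MP: "M \<subseteq> PIdl c <+> M"
  proof
    fix x assume "x \<in> M"
    moreover from this have "x = \<zero> \<oplus> x" using ideal.Icarr[OF M] by simp
    moreover have "\<zero> \<in> PIdl c" using additive_subgroup.zero_closed[OF ideal.axioms(1)[OF P]] .
    ultimately show "x \<in> PIdl c <+> M" unfolding set_add_def' by blast
  qed
  have split: "\<exists>l\<in>L. \<exists>v\<in>L \<cdot> M. s = l \<otimes> c \<oplus> v" if "s \<in> A \<cdot> (PIdl c <+> M)" for s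
  proof -
    have "s \<in> L \<cdot> (PIdl c) <+> L \<cdot> M"
      using that le ideal_prod_r_distr[OF L P M] by blast
    then show ?thesis
      unfolding ideal_prod_cgenideal[OF L c] set_add_def' by blast
  qed
  have "A \<cdot> (A \<cdot> M) \<subseteq> A \<cdot> (L \<cdot> M)"
  proof (rule ideal_prod_subsetI[OF T])
    fix y w assume y: "y \<in> A" and w: "w \<in> A \<cdot> M"
    have "w \<in> A \<cdot> (PIdl c <+> M)" using w ideal_prod_mono[OF order_refl MP] by blast
    then obtain l' v where l': "l' \<in> L" and v: "v \<in> L \<cdot> M" and weq: "w = l' \<otimes> c \<oplus> v"
      using split by blast
    have "y \<otimes> c \<in> A \<cdot> (PIdl c <+> M)" using y cM by (rule ideal_prod.prod)
    then obtain l u where l: "l \<in> L" and u: "u \<in> L \<cdot> M" and yeq: "y \<otimes> c = l \<otimes> c \<oplus> u"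
      using split by blast
    have carr: "y \<in> carrier R" "w \<in> carrier R" "l \<in> carrier R" "l' \<in> carrier R"
      "u \<in> carrier R" "v \<in> carrier R"
      using y w l l' u v by (auto intro: ideal.Icarr[OF A] ideal.Icarr[OF L] ideal.Icarr[OF LM] ideal.Icarr[OF AM])
    have ueq: "u = y \<otimes> c \<ominus> l \<otimes> c"
      using yeq carr c by algebra
    \<comment> \<open>Expand \<open>y \<otimes> w = l' \<otimes> (y \<otimes> c) \<oplus> y
      \<otimes> v\<close>, replace \<open>y \<otimes> c\<close> by
      \<open>l \<otimes> c \<oplus> u\<close>, and then \<open>l' \<otimes> c\<close> by
      \<open>w \<ominus> v\<close>. Now \<open>c\<close> is gone and each summand has a factor in
      \<open>A\<close>, one in \<open>L\<close> and one in \<open>M\<close>.\<close>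
    have "y \<otimes> w = l \<otimes> w \<oplus> (l' \<otimes> u \<oplus> (y \<ominus> l) \<otimes> v)"
      unfolding ueq weq using carr c by algebra
    moreover have "l \<otimes> w \<in> A \<cdot> (L \<cdot> M)"
    proof -
      have "l \<otimes> w \<in> L \<cdot> (A \<cdot> M)" using l w by (rule ideal_prod.prod)
      also have "L \<cdot> (A \<cdot> M) = (A \<cdot> L) \<cdot> M"
        by (simp only: ideal_prod_assoc[symmetric] ideal_prod_commute[of L A] A L M)
      finally show ?thesis by (simp only: ideal_prod_assoc A L M)
    qed
    moreover have "l' \<otimes> u \<in> A \<cdot> (L \<cdot> M)"
      using l' u \<open>L \<subseteq> A\<close> by (intro ideal_prod.prod) auto
    moreover have "(y \<ominus> l) \<otimes> v \<in> A \<cdot> (L \<cdot> M)"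
      using y l v \<open>L \<subseteq> A\<close> by (intro ideal_prod.prod) (auto simp: a_minus_def)
    ultimately show "y \<otimes> w \<in> A \<cdot> (L \<cdot> M)"
      by (simp add: ideal_prod.sum)
  qed
  then show ?thesis by (simp only: ideal_prod_assoc A L M)
qed

section \<open>Colon ideals\<close>

lemma ideal_colon_ideal:
  assumes "ideal A R" "ideal B R"
  shows "ideal (ideal_colon R A B) R"
proof -
  interpret A: ideal A R by fact
  have mem: "r \<in> ideal_colon R A B \<longleftrightarrow> r \<in> carrier R \<and> (\<forall>b\<in>B. r \<otimes> b \<in> A)" for r
    by (auto simp: ideal_colon_def l_coset_def)
  have B: "b \<in> carrier R" if "b \<in> B" for b using ideal.Icarr[OF assms(2) that] .
  have "\<zero> \<in> ideal_colon R A B" by (simp add: mem B)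
  then have ne: "ideal_colon R A B \<noteq> {}" by blast
  show ?thesis
  proof (rule idealI)
    show "subgroup (ideal_colon R A B) (add_monoid R)"
      by (rule add.subgroupI) (auto simp: mem ne B l_distr l_minus simp flip: a_inv_def)
  next
    fix a x assume a: "a \<in> ideal_colon R A B" and x: "x \<in> carrier R"
    then have "x \<otimes> a \<otimes> b \<in> A" if "b \<in> B" for b
      using that by (auto simp: mem B m_assoc A.I_l_closed)
    with a x show "x \<otimes> a \<in> ideal_colon R A B" by (simp add: mem)
    with a x show "a \<otimes> x \<in> ideal_colon R A B" by (simp add: mem m_comm)
  qed (rule ring_axioms)
qed

lemma ideal_prod_ideal_colon:
  assumes "ideal A R" "J \<subseteq> ideal_colon R A B"
  shows "J \<cdot> B \<subseteq> A"
  using assms by (intro ideal_prod_subsetI) (auto simp: ideal_colon_def l_coset_def)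

text \<open>Multiplying \<open>C \<cdot> I^m \<subseteq> I^(m+1)\<close> by \<open>I^(k-m)\<close>
  raises both exponents. Hence the union defining \<open>ratliff_rush\<close> is an ascending
  one.\<close>

lemma ideal_colon_pow_mono:
  assumes I: "ideal I R" and "m \<le> k"
  shows "ideal_colon R (ideal_pow R I (m + 1)) (ideal_pow R I m)
    \<subseteq> ideal_colon R (ideal_pow R I (k + 1)) (ideal_pow R I k)"
proof
  define C where "C = ideal_colon R (ideal_pow R I (m + 1)) (ideal_pow R I m)"
  note ids = I ideal_pow_ideal[OF I]
  have C: "ideal C R" unfolding C_def by (intro ideal_colon_ideal ids)
  have "C \<cdot> ideal_pow R I m \<subseteq> ideal_pow R I (m + 1)"
    unfolding C_def by (intro ideal_prod_ideal_colon ids order_refl)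
  then have "(C \<cdot> ideal_pow R I m) \<cdot> ideal_pow R I (k - m)
      \<subseteq> ideal_pow R I (m + 1) \<cdot> ideal_pow R I (k - m)"
    by (rule ideal_prod_mono[OF _ order_refl])
  then have *: "C \<cdot> ideal_pow R I k \<subseteq> ideal_pow R I (k + 1)"
    using \<open>m \<le> k\<close> by (simp only: ideal_prod_assoc C ids ideal_pow_add) simp
  fix r assume r: "r \<in> ideal_colon R (ideal_pow R I (m + 1)) (ideal_pow R I m)"
  then have "r \<otimes> x \<in> C \<cdot> ideal_pow R I k" if "x \<in> ideal_pow R I k" for x
    using that by (auto simp: C_def intro: ideal_prod.prod)
  with * r show "r \<in> ideal_colon R (ideal_pow R I (k + 1)) (ideal_pow R I k)"
    by (auto simp: ideal_colon_def l_coset_def)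
qed

end

section \<open>Cancellation and reductions over a domain\<close>

context domain
begin

lemma ideal_prod_nonzero:
  assumes "ideal I R" "ideal J R" "I \<noteq> {\<zero>}" "J \<noteq> {\<zero>}"
  shows "I \<cdot> J \<noteq> {\<zero>}"
proof -
  have ex: "\<exists>x\<in>K. x \<noteq> \<zero>" if "ideal K R" "K \<noteq> {\<zero>}" for K
    using that additive_subgroup.zero_closed[OF ideal.axioms(1)] by blast
  obtain x y where "x \<in> I" "x \<noteq> \<zero>" "y \<in> J" "y \<noteq> \<zero>"
    using ex assms by meson
  then have "x \<otimes> y \<in> I \<cdot> J" "x \<otimes> y \<noteq> \<zero>"
    using ideal.Icarr[OF assms(1)] ideal.Icarr[OF assms(2)]
    by (auto intro: ideal_prod.prod simp: integral_iff)
  then show ?thesis by blast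
qed

lemma ideal_pow_nonzero:
  assumes "ideal I R" "I \<noteq> {\<zero>}"
  shows "ideal_pow R I n \<noteq> {\<zero>}"
proof (induct n)
  case 0
  show ?case unfolding ideal_pow_0 using carrier_one_not_zero by (simp add: carrier_one_zero)
next
  case (Suc n)
  then show ?case unfolding ideal_pow_Suc
    using assms by (intro ideal_prod_nonzero ideal_pow_ideal)
qed

text \<open>Induction on \<open>B\<close> with \<open>A\<close> and \<open>L\<close> arbitrary,
  because eliminating a generator replaces the pair by \<open>A \<cdot> A\<close> and
  \<open>A \<cdot> L\<close>. The nonzero generator \<open>b\<close> is kept apart from
  \<open>B\<close> so that it is the one left at the end.\<close>

lemma ideal_reduction_of_generators:
  assumes "finite B" "B \<subseteq> carrier R" "b \<in> carrier R" "b \<noteq> \<zero>"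
    and "ideal A R" "ideal L R" "L \<subseteq> A"
    and "A \<cdot> (Idl (insert b B)) \<subseteq> L \<cdot> (Idl (insert b B))"
  shows "\<exists>n. ideal_pow R A (Suc n) \<subseteq> L \<cdot> ideal_pow R A n"
  using assms
proof (induct B arbitrary: A L rule: finite_induct)
  case empty
  interpret A: ideal A R by fact
  interpret L: ideal L R by fact
  have sub: "A \<cdot> (PIdl b) \<subseteq> L \<cdot> (PIdl b)"
    using empty by (simp add: cgenideal_eq_genideal)
  \<comment> \<open>Only \<open>b\<close> is left, and products with \<open>PIdl b\<close> are plain
    multiples of \<open>b\<close>, so \<open>b\<close> cancels. The exponent \<open>n = 0\<close>
    then works.\<close>
  have "A \<subseteq> L"
  proof
    fix a assume a: "a \<in> A"
    with sub empty obtain l where l: "l \<in> L" "a \<otimes> b = l \<otimes> b"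
      by (auto simp: ideal_prod_cgenideal)
    with a empty have "a = l" by (simp add: m_rcancel)
    with l show "a \<in> L" by simp
  qed
  then have "ideal_pow R A (Suc 0) \<subseteq> L \<cdot> ideal_pow R A 0"
    using empty by (simp only: ideal_pow_1 ideal_pow_0 ideal_prod_one)
  then show ?case by blast
next
  case (insert c B)
  note A = \<open>ideal A R\<close> and L = \<open>ideal L R\<close>
  have "Idl (insert b (insert c B)) = PIdl c <+> Idl (insert b B)"
    using insert by (subst insert_commute) (intro genideal_insert, auto)
  moreover have "ideal (Idl (insert b B)) R"
    using insert by (intro genideal_ideal) auto
  ultimately have "(A \<cdot> A) \<cdot> (Idl (insert b B)) \<subseteq> (A \<cdot> L) \<cdot> (Idl (insert b B))"
    using insert by (intro ideal_prod_eliminate[where c = c]) auto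
  moreover have AA: "ideal (A \<cdot> A) R" "ideal (A \<cdot> L) R"
    using A L by (auto intro: ideal_prod_is_ideal)
  moreover have "A \<cdot> L \<subseteq> A \<cdot> A" using insert by (intro ideal_prod_mono) auto
  ultimately obtain n where n: "ideal_pow R (A \<cdot> A) (Suc n) \<subseteq> (A \<cdot> L) \<cdot> ideal_pow R (A \<cdot> A) n"
    using insert.hyps(3)[of "A \<cdot> A" "A \<cdot> L"] insert.prems by blast
  have sq: "ideal_pow R (A \<cdot> A) k = ideal_pow R A (2 * k)" for k
  proof (induct k)
    case 0
    show ?case by (simp only: ideal_pow_0 mult_0_right)
  next
    case (Suc k)
    have "2 * Suc k = 2 * k + Suc (Suc 0)" by simp
    then show ?case using Suc A
      by (simp only: ideal_pow_add[symmetric] ideal_pow_Suc ideal_pow_0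
            ideal_prod_commute[of "carrier R" A] oneideal ideal_prod_one)
  qed
  have "ideal_pow R A (Suc (Suc (2 * n))) \<subseteq> (A \<cdot> L) \<cdot> ideal_pow R A (2 * n)"
    using n unfolding sq by simp
  \<comment> \<open>The spare factor \<open>A\<close> joins the power, so the witness for the pair
    \<open>A\<close>, \<open>L\<close> is \<open>2 * n + 1\<close>.\<close>
  also have "\<dots> = L \<cdot> ideal_pow R A (Suc (2 * n))"
    using A L by (simp only: ideal_prod_commute[of A L] ideal_prod_assoc ideal_pow_ideal ideal_pow_Suc2)
  finally show ?case by blast
qed

end

lemma (in noetherian_domain) ideal_reduction:
  assumes I: "ideal I R" and J: "ideal J R" and M: "ideal M R"
    and "I \<subseteq> J" "M \<noteq> {\<zero>}" and le: "J \<cdot> M \<subseteq> I \<cdot> M"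
  shows "\<exists>n. ideal_pow R J (Suc n) \<subseteq> I \<cdot> ideal_pow R J n"
proof -
  obtain B where B: "B \<subseteq> carrier R" "finite B" "M = Idl B"
    using finetely_gen[OF M] by blast
  \<comment> \<open>If all generators were zero, \<open>M\<close> would be zero. The element
    \<open>b\<close> found here is the one that is finally cancelled.\<close>
  obtain b where b: "b \<in> B" "b \<noteq> \<zero>"
  proof (rule ccontr)
    assume "\<not> thesis"
    with that have "B \<subseteq> {\<zero>}" by blast
    then have "M \<subseteq> {\<zero>}" using B genideal_minimal[OF zeroideal] by blast
    with \<open>M \<noteq> {\<zero>}\<close> additive_subgroup.zero_closed[OF ideal.axioms(1)[OF M]] show False by blast
  qed
  then have "M = Idl (insert b B)" using B by (simp add: insert_absorb)
  with b B assms show ?thesis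
    by (intro ideal_reduction_of_generators[of B b]) auto
qed

text \<open>Each of finitely many generators of \<open>J\<close> lies in some member of the chain,
  and the largest index serves them all. This turns containment in \<open>ratliff_rush\<close> into
  containment in a single colon ideal.\<close>

lemma (in noetherian_ring) finitely_generated_subset_chain:
  assumes "ideal J R" "J \<subseteq> (\<Union>m\<in>{k..}. C m)"
    and ideal: "\<And>m::nat. ideal (C m) R" and mono: "\<And>m n. m \<le> n \<Longrightarrow> C m \<subseteq> C n"
  shows "\<exists>m\<ge>k. J \<subseteq> C m"
proof -
  obtain A where A: "A \<subseteq> carrier R" "finite A" "J = Idl A"
    using finetely_gen[OF assms(1)] by blast
  have "A \<subseteq> J" using A genideal_self by blast
  then have "\<forall>a\<in>A. \<exists>m. a \<in> C m" using assms(2) by blast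
  then obtain f where f: "\<And>a. a \<in> A \<Longrightarrow> a \<in> C (f a)" by metis
  \<comment> \<open>Inserting \<open>k\<close> gives \<open>m \<ge> k\<close> and keeps the set
    nonempty even if \<open>A\<close> is empty.\<close>
  define m where "m = Max (insert k (f ` A))"
  have "k \<le> m" unfolding m_def using A by (intro Max_ge) auto
  moreover have "A \<subseteq> C m"
  proof
    fix a assume "a \<in> A"
    then have "f a \<le> m" unfolding m_def using A by (intro Max_ge) auto
    then show "a \<in> C m" using f[OF \<open>a \<in> A\<close>] mono by blast
  qed
  ultimately show ?thesis using A(3) genideal_minimal[OF ideal] by blast
qed

text \<open>For \<open>I = {\<zero>}\<close> the formula for the closure gives the whole ring, by
  \<open>ratliff_rush_zero\<close>. Without the condition \<open>I \<noteq> {\<zero>}\<close> the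
  right-hand side would therefore fail for every nonzero \<open>J\<close>.\<close>

theorem theorem3p3:
  fixes R :: "('a, 'b) ring_scheme" (structure) and J :: "'a set"
  assumes "noetherian_domain R" and "ideal J R"
  shows "big_ideal R J \<longleftrightarrow>
    (\<forall>I. ideal I R \<and> I \<noteq> {\<zero>} \<and> I \<subset> J \<longrightarrow> \<not> J \<subseteq> ratliff_rush R I)"
proof -
  interpret noetherian_domain R by fact
  note J = \<open>ideal J R\<close>
  show ?thesis
  proof (intro iffI allI impI notI)
    fix I
    assume big: "big_ideal R J" and "ideal I R \<and> I \<noteq> {\<zero>} \<and> I \<subset> J"
      and sub: "J \<subseteq> ratliff_rush R I"
    then have I: "ideal I R" and nz: "I \<noteq> {\<zero>}" and IJ: "I \<subset> J" by auto
    note ids = I J ideal_pow_ideal[OF I] ideal_pow_ideal[OF J] ideal_prod_is_ideal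
    obtain m where "m \<ge> 1"
      and m: "J \<subseteq> ideal_colon R (ideal_pow R I (m + 1)) (ideal_pow R I m)"
      using finitely_generated_subset_chain[OF J sub[unfolded ratliff_rush_def]
          ideal_colon_ideal[OF ids(3) ids(3)] ideal_colon_pow_mono[OF I]] by blast
    have le: "J \<cdot> ideal_pow R I m \<subseteq> I \<cdot> ideal_pow R I m"
      using ideal_prod_ideal_colon[OF ids(3) m] I by (simp only: Suc_eq_plus1[symmetric] ideal_pow_Suc2)
    obtain n where n: "J \<cdot> ideal_pow R J n \<subseteq> I \<cdot> ideal_pow R J n"
      using ideal_reduction[OF I J ids(3) _ ideal_pow_nonzero[OF I nz] le] IJ J
      by (auto simp only: ideal_pow_Suc2)
    have "ideal_pow R J (m + n) = ideal_pow R J m \<cdot> ideal_pow R J n"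
      using J by (simp only: ideal_pow_add)
    \<comment> \<open>Two exchanges follow: \<open>J^m\<close> becomes \<open>I^m\<close> against
      the multiplier \<open>J^n\<close>, and then \<open>J^n\<close> becomes \<open>I^n\<close>
      against the multiplier \<open>I^m\<close> just created.\<close>
    also have "\<dots> \<subseteq> ideal_pow R I m \<cdot> ideal_pow R J n"
      by (rule ideal_prod_pow_subset[OF J I ids(4) n])
    also have "\<dots> = ideal_pow R J n \<cdot> ideal_pow R I m"
      by (intro ideal_prod_commute ids)
    also have "\<dots> \<subseteq> ideal_pow R I n \<cdot> ideal_pow R I m"
      by (rule ideal_prod_pow_subset[OF J I ids(3) le])
    also have "\<dots> = ideal_pow R I (m + n)"
      using I by (simp only: ideal_pow_add add.commute)
    finally have "ideal_pow R J (m + n) \<subseteq> ideal_pow R I (m + n)" .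
    \<comment> \<open>Bigness speaks only of positive exponents; \<open>m \<ge> 1\<close> secures
      this even when \<open>n = 0\<close>.\<close>
    moreover have "ideal_pow R I (m + n) \<subset> ideal_pow R J (m + n)"
      using big I IJ \<open>m \<ge> 1\<close> unfolding big_ideal_def by auto
    ultimately show False by blast
  next
    assume notsub: "\<forall>I. ideal I R \<and> I \<noteq> {\<zero>} \<and> I \<subset> J \<longrightarrow> \<not> J \<subseteq> ratliff_rush R I"
    have "ideal_pow R I n \<subset> ideal_pow R J n" if I: "ideal I R" and IJ: "I \<subset> J" and "n \<ge> 1" for I n
    proof (rule ccontr)
      assume "\<not> ?thesis"
      with IJ have eq: "ideal_pow R I n = ideal_pow R J n"
        using ideal_pow_mono[of I J n] by blast
      obtain k where k: "n = Suc k" using \<open>n \<ge> 1\<close> by (cases n) auto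
      note ids = I J ideal_pow_ideal[OF I] ideal_pow_ideal[OF J]
      \<comment> \<open>The assumption says nothing about the zero ideal, which is excluded
        separately: it would make \<open>J^n\<close> zero although \<open>J\<close> is not.\<close>
      have "I \<noteq> {\<zero>}"
      proof
        assume I0: "I = {\<zero>}"
        have "ideal_pow R I n = {\<zero>}"
          unfolding k ideal_pow_Suc I0 by (intro ideal_prod_zero ideal_pow_ideal zeroideal)
        moreover have "J \<noteq> {\<zero>}" using IJ I0 by blast
        ultimately show False using eq ideal_pow_nonzero[OF J] by metis
      qed
      then have no: "\<not> J \<subseteq> ratliff_rush R I" using notsub I IJ by blast
      \<comment> \<open>Split one factor off \<open>J^n = I^n = I^k \<cdot> I\<close> and enlarge
        only \<open>I^k\<close> to \<open>J^k\<close>. A further factor \<open>J\<close> then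
        restores \<open>J^n\<close>, which equals \<open>I^n\<close>.\<close>
      have "ideal_pow R J n \<subseteq> ideal_pow R J k \<cdot> I"
        unfolding eq[symmetric] unfolding k ideal_pow_Suc
        using IJ by (intro ideal_prod_mono ideal_pow_mono) auto
      then have "J \<cdot> ideal_pow R J n \<subseteq> J \<cdot> (ideal_pow R J k \<cdot> I)"
        by (intro ideal_prod_mono order_refl)
      also have "\<dots> = ideal_pow R J n \<cdot> I"
        unfolding k by (simp only: ideal_prod_assoc[symmetric] ideal_pow_Suc2 ids)
      also have "\<dots> = ideal_pow R I (n + 1)"
        unfolding eq[symmetric] by (simp only: Suc_eq_plus1[symmetric] ideal_pow_Suc)
      finally have *: "J \<cdot> ideal_pow R I n \<subseteq> ideal_pow R I (n + 1)" unfolding eq .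
      have "J \<subseteq> ideal_colon R (ideal_pow R I (n + 1)) (ideal_pow R I n)"
      proof
        fix r assume r: "r \<in> J"
        then have "r \<otimes> x \<in> ideal_pow R I (n + 1)" if "x \<in> ideal_pow R I n" for x
          using that * ideal_prod.prod[of r J x "ideal_pow R I n" R] by blast
        then show "r \<in> ideal_colon R (ideal_pow R I (n + 1)) (ideal_pow R I n)"
          using ideal.Icarr[OF J r] unfolding ideal_colon_def l_coset_def by blast
      qed
      then have "J \<subseteq> ratliff_rush R I"
        using \<open>n \<ge> 1\<close> unfolding ratliff_rush_def by blast
      with no show False by blast
    qed
    then show "big_ideal R J" using J unfolding big_ideal_def by blast
  qed
qed

end
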